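(* Let $\gamma=(\gamma_1,\gamma_2)\in\mathbb{R}^2$ with $\gamma\succ(1,1)$, and let $\alpha=(\alpha_1,\alpha_2)\in\mathbb{R}^2$ with $\alpha\preceq\gamma$. Then there is a function $f:\mathbb{U}^2\to\mathbb{C}$ such that $f_{w_0}\in\mathcal{M}(D_{\gamma_1},D_{\alpha_1})$ and $f_{z_0}\in\mathcal{M}(D_{\gamma_2},D_{\alpha_2})$ for each $z_0,w_0\in\mathbb{U}$, but $f\notin\mathcal{M}(D_\gamma,D_\alpha)$.
   Context: $\mathbb{U}$ is the open unit disc in $\mathbb{C}$, $\mathbb{U}^2=\mathbb{U}\times\mathbb{U}$, and $\mathbb{Z}_+$ is the set of nonnegative integers. For $\alpha=(\alpha_1,\alpha_2)\in\mathbb{R}^2$, $D_\alpha$ is the space of functions $f(z,w)=\sum_{(k,l)\in\mathbb{Z}_+^2}a_{k,l}z^kw^l$ on $\mathbb{U}^2$ with $\sum_{(k,l)}|a_{k,l}|^2(k+1)^{\alpha_1}(l+1)^{\alpha_2}<\infty$. For $a\in\mathbb{R}$, $D_a$ is the one-variable space of functions $g(z)=\sum_{k\in\mathbb{Z}_+}b_kz^k$ on $\mathbb{U}$ with $\sum_k|b_k|^2(k+1)^a<\infty$. $\mathcal{M}(D_\gamma,D_\alpha)$ is the set of functions $\phi:\mathbb{U}^2\to\mathbb{C}$ such that $\phi f\in D_\alpha$ for all $f\in D_\gamma$; for real $a,b$, $\mathcal{M}(D_a,D_b)$ is the set of functions $\phi:\mathbb{U}\to\mathbb{C}$ such that $\phi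 g\in D_b$ for all $g\in D_a$. For $f:\mathbb{U}^2\to\mathbb{C}$ and fixed $w_0\in\mathbb{U}$, $f_{w_0}(z)=f(z,w_0)$; for fixed $z_0\in\mathbb{U}$, $f_{z_0}(w)=f(z_0,w)$. For vectors in $\mathbb{R}^2$: $\gamma\succ\alpha$ means $\gamma_1>\alpha_1$ and $\gamma_2>\alpha_2$; $\alpha\preceq\gamma$ means $\alpha_1\le\gamma_1$ and $\alpha_2\le\gamma_2$. *)

theory Defs
  imports "HOL-Analysis.Analysis"
begin

abbreviation unit_disc :: "complex set" where
  "unit_disc \<equiv> ball 0 1"

text \<open>Functions on the disc and the bidisc are represented by total functions; neither membership
  predicate below looks at values outside the disc or the bidisc, respectively.\<close>

definition dirichlet_disc :: "real \<Rightarrow> (complex \<Rightarrow> complex) set" where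
  "dirichlet_disc a = {g. \<exists>b :: nat \<Rightarrow> complex.
     summable (\<lambda>k. (cmod (b k))\<^sup>2 * (real k + 1) powr a) \<and>
     (\<forall>z \<in> unit_disc. (\<lambda>k. b k * z ^ k) sums g z)}"

text \<open>The double series is summed unconditionally. This is no restriction: weighted square
  summability makes the coefficients grow at most polynomially, so that the series converges
  absolutely at every point of the bidisc.\<close>

definition dirichlet_bidisc :: "real \<times> real \<Rightarrow> (complex \<times> complex \<Rightarrow> complex) set" where
  "dirichlet_bidisc \<alpha> = {f. \<exists>a :: nat \<times> nat \<Rightarrow> complex.
     (\<lambda>(k, l). (cmod (a (k, l)))\<^sup>2 * (real k + 1) powr fst \<alpha> * (real l + 1) powr snd \<alpha>)
       summable_on UNIV \<and>
     (\<forall>z \<in> unit_disc. \<forall>w \<in> unit_disc.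
       ((\<lambda>(k, l). a (k, l) * z ^ k * w ^ l) has_sum f (z, w)) UNIV)}"

definition multipliers :: "('a \<Rightarrow> complex) set \<Rightarrow> ('a \<Rightarrow> complex) set \<Rightarrow> ('a \<Rightarrow> complex) set" where
  "multipliers X Y = {\<phi>. \<forall>f \<in> X. (\<lambda>x. \<phi> x * f x) \<in> Y}"

end

theory Submission
  imports Defs "HOL-Real_Asymp.Real_Asymp" "HOL-Complex_Analysis.Laurent_Convergence"
begin

text \<open>The counterexample is \<open>f (z, w) = (\<Sum>k. c k * (z * w) ^ k)\<close> with
  \<open>c k = (k + 1) powr (- (\<alpha>\<^sub>1 + \<alpha>\<^sub>2) / 2)\<close>. All its coefficients lie on the diagonal, and \<open>c k\<close> is
  chosen so that each of them contributes exactly \<open>1\<close> to the weighted square sum of \<open>D\<^sub>\<alpha>\<close>. By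
  uniqueness of the double power series (\<open>diagonal_coeffs\<close>), \<open>f\<close> is therefore not in \<open>D\<^sub>\<alpha>\<close>. As the
  constant function \<open>1\<close> is in \<open>D\<^sub>\<gamma>\<close>, and a multiplier has to send it into \<open>D\<^sub>\<alpha>\<close>, \<open>f\<close> is not a
  multiplier.

  Fixing one variable at a point \<open>x\<close> of the disc, however, turns the coefficients into
  \<open>c k * x ^ k\<close>: polynomial growth against exponential decay, since \<open>cmod x < 1\<close>. A power series
  with such coefficients multiplies \<open>D\<^sub>g\<close> into itself for each \<open>g \<ge> 0\<close>
  (\<open>multiplier_of_weighted_summable\<close>), and \<open>D\<^sub>g\<close> is contained in \<open>D\<^sub>a\<close> for \<open>a \<le> g\<close>. The failure
  comes from letting both variables approach the boundary together, which no slice detects.\<close>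

lemma mult_in_unit_disc:
  assumes "z \<in> unit_disc" and "w \<in> unit_disc"
  shows "z * w \<in> unit_disc"
proof -
  have "cmod z * cmod w \<le> 1 * cmod w"
    by (rule mult_right_mono) (use assms in simp_all)
  also have "\<dots> < 1" using assms by simp
  finally show ?thesis by (simp add: norm_mult)
qed

lemma summable_powr_times_geometric:
  fixes r s :: real
  assumes "0 \<le> r" and "r < 1"
  shows "summable (\<lambda>k. (real k + 1) powr s * r ^ k)"
proof (cases "r = 0")
  case True
  show ?thesis unfolding True by (rule summable_0_powser)
next
  case False
  with assms have "0 < r" by simp
  have "summable (\<lambda>k. norm (1 / real k ^ 2))"
    using inverse_power_summable[of 2, where 'a = real] by (simp add: field_simps)
  moreover have "(\<lambda>k. (real k + 1) powr s * r ^ k) \<in> O(\<lambda>k. 1 / real k ^ 2)"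
    using \<open>0 < r\<close> \<open>r < 1\<close> by real_asymp
  ultimately show ?thesis
    by (rule summable_comparison_test_bigo)
qed

text \<open>Multiplication by \<open>z ^ j\<close> has norm at most \<open>(j + 1) powr (a / 2)\<close> on \<open>D\<^sub>a\<close>
  for \<open>a \<ge> 0\<close>, because \<open>j + k + 1 \<le> (j + 1) * (k + 1)\<close>; this is where the weights enter the multiplier estimate.\<close>

lemma weight_submultiplicative:
  fixes a :: real
  assumes "0 \<le> a"
  shows "(real (j + k) + 1) powr a \<le> (real j + 1) powr a * (real k + 1) powr a"
proof -
  have "(real (j + k) + 1) powr a \<le> ((real j + 1) * (real k + 1)) powr a"
    by (rule powr_mono2) (use assms in \<open>simp_all add: algebra_simps\<close>)
  then show ?thesis by (simp add: powr_mult)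
qed

text \<open>Young's inequality for the convolution of \<open>\<ell>\<^sup>1\<close> with \<open>\<ell>\<^sup>2\<close>. Submultiplicativity lets the weight
  be distributed over the two factors, giving \<open>p\<close> in \<open>\<ell>\<^sup>1\<close> and \<open>q\<close> in \<open>\<ell>\<^sup>2\<close>. Splitting
  \<open>p j\<close> as \<open>sqrt (p j) * sqrt (p j)\<close> in the Cauchy--Schwarz inequality then leaves the
  Cauchy product of the summable sequences \<open>p\<close> and \<open>q\<^sup>2\<close>.\<close>

lemma convolution_weighted_square_summable:
  fixes d b :: "nat \<Rightarrow> complex" and a :: real
  assumes "0 \<le> a"
    and d: "summable (\<lambda>j. cmod (d j) * (real j + 1) powr (a / 2))"
    and b: "summable (\<lambda>k. (cmod (b k))\<^sup>2 * (real k + 1) powr a)"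
  shows "summable (\<lambda>n. (cmod (\<Sum>j\<le>n. d j * b (n - j)))\<^sup>2 * (real n + 1) powr a)"
proof -
  define p where "p j = cmod (d j) * (real j + 1) powr (a / 2)" for j
  define q where "q k = cmod (b k) * (real k + 1) powr (a / 2)" for k
  have p0: "0 \<le> p j" and q0: "0 \<le> q j" for j by (simp_all add: p_def q_def)
  have sq: "x powr a = (x powr (a / 2))\<^sup>2" for x :: real
    by (simp add: power2_eq_square flip: powr_add)
  have sp: "summable p" using d by (simp add: p_def[abs_def])
  have sq2: "summable (\<lambda>k. (q k)\<^sup>2)"
    using b by (simp add: q_def[abs_def] power_mult_distrib sq)
  have conv: "summable (\<lambda>n. \<Sum>j\<le>n. p j * (q (n - j))\<^sup>2)"
    by (rule summable_Cauchy_product) (use sp sq2 p0 in \<open>simp_all\<close>)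
  have bound: "(cmod (\<Sum>j\<le>n. d j * b (n - j)))\<^sup>2 * (real n + 1) powr a
      \<le> suminf p * (\<Sum>j\<le>n. p j * (q (n - j))\<^sup>2)" for n
  proof -
    have "cmod (\<Sum>j\<le>n. d j * b (n - j)) * (real n + 1) powr (a / 2)
        \<le> (\<Sum>j\<le>n. cmod (d j) * cmod (b (n - j))) * (real n + 1) powr (a / 2)"
      by (intro mult_right_mono sum_norm_le) (simp_all add: norm_mult)
    also have "\<dots> \<le> (\<Sum>j\<le>n. p j * q (n - j))"
      unfolding sum_distrib_right
    proof (rule sum_mono)
      fix j assume "j \<in> {..n}"
      then have n: "n = j + (n - j)" by simp
      have "(real n + 1) powr (a / 2) \<le> (real j + 1) powr (a / 2) * (real (n - j) + 1) powr (a / 2)"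
        by (subst n, rule weight_submultiplicative) (use assms in simp)
      then have "(cmod (d j) * cmod (b (n - j))) * (real n + 1) powr (a / 2) \<le>
          (cmod (d j) * cmod (b (n - j))) * ((real j + 1) powr (a / 2) * (real (n - j) + 1) powr (a / 2))"
        by (rule mult_left_mono) simp
      then show "cmod (d j) * cmod (b (n - j)) * (real n + 1) powr (a / 2) \<le> p j * q (n - j)"
        by (simp add: p_def q_def mult_ac)
    qed
    finally have "(cmod (\<Sum>j\<le>n. d j * b (n - j)) * (real n + 1) powr (a / 2))\<^sup>2
        \<le> (\<Sum>j\<le>n. p j * q (n - j))\<^sup>2"
      by (rule power_mono) simp
    also have "\<dots> = (\<Sum>j\<le>n. sqrt (p j) * (sqrt (p j) * q (n - j)))\<^sup>2"
      using p0 by (simp flip: mult.assoc)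
    also have "\<dots> \<le> (\<Sum>j\<le>n. (sqrt (p j))\<^sup>2) * (\<Sum>j\<le>n. (sqrt (p j) * q (n - j))\<^sup>2)"
      by (rule Cauchy_Schwarz_ineq_sum)
    also have "\<dots> = (\<Sum>j\<le>n. p j) * (\<Sum>j\<le>n. p j * (q (n - j))\<^sup>2)"
      using p0 by (simp add: power_mult_distrib)
    also have "\<dots> \<le> suminf p * (\<Sum>j\<le>n. p j * (q (n - j))\<^sup>2)"
      by (intro mult_right_mono sum_le_suminf sum_nonneg mult_nonneg_nonneg)
         (use sp p0 in auto)
    finally show ?thesis by (simp add: power_mult_distrib sq)
  qed
  show ?thesis
    by (rule summable_comparison_test'[OF summable_mult[OF conv, of "suminf p"], of 0])
       (use bound in simp)
qed

text \<open>Convergence at every point of the disc, in particular at one of larger modulus than \<open>z\<close>,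
  forces absolute convergence at \<open>z\<close>. Membership in \<open>dirichlet_disc\<close> supplies only the former, while
  the Cauchy product needs the latter.\<close>

lemma power_series_abs_summable:
  fixes b :: "nat \<Rightarrow> complex"
  assumes "\<And>z. z \<in> unit_disc \<Longrightarrow> (\<lambda>k. b k * z ^ k) sums g z" and "z \<in> unit_disc"
  shows "summable (\<lambda>k. norm (b k * z ^ k))"
proof -
  obtain r where r: "cmod z < r" "r < 1" using assms(2) dense by auto
  then have "0 < r" using norm_ge_zero[of z] by linarith
  with r have "complex_of_real r \<in> unit_disc" by simp
  then have "summable (\<lambda>k. b k * complex_of_real r ^ k)"
    using assms(1) sums_summable by blast
  then show ?thesis
    by (rule powser_insidea) (use r \<open>0 < r\<close> in simp)
qed

text \<open>The hypothesis says that the operator norms of the terms \<open>d j * z ^ j\<close> on \<open>D\<^sub>a\<close> are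
  summable, so their sum is a bounded multiplication operator. In terms of coefficients, the
  operator is convolution with \<open>d\<close>.\<close>

lemma multiplier_of_weighted_summable:
  fixes d :: "nat \<Rightarrow> complex"
  assumes "0 \<le> a"
    and d: "summable (\<lambda>j. cmod (d j) * (real j + 1) powr (a / 2))"
    and phi: "\<And>z. z \<in> unit_disc \<Longrightarrow> (\<lambda>j. d j * z ^ j) sums \<phi> z"
  shows "\<phi> \<in> multipliers (dirichlet_disc a) (dirichlet_disc a)"
  unfolding multipliers_def
proof (intro CollectI ballI)
  fix g assume "g \<in> dirichlet_disc a"
  then obtain b where b: "summable (\<lambda>k. (cmod (b k))\<^sup>2 * (real k + 1) powr a)"
    and g: "\<And>z. z \<in> unit_disc \<Longrightarrow> (\<lambda>k. b k * z ^ k) sums g z"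
    unfolding dirichlet_disc_def by auto
  have "(\<lambda>n. (\<Sum>j\<le>n. d j * b (n - j)) * z ^ n) sums (\<phi> z * g z)" if z: "z \<in> unit_disc" for z
  proof -
    have "(\<lambda>n. \<Sum>j\<le>n. (d j * z ^ j) * (b (n - j) * z ^ (n - j))) sums
        ((\<Sum>j. d j * z ^ j) * (\<Sum>k. b k * z ^ k))"
      using power_series_abs_summable[OF phi z] power_series_abs_summable[OF g z]
      by (rule Cauchy_product_sums)
    also have "(\<Sum>j. d j * z ^ j) = \<phi> z" using phi[OF z] by (simp add: sums_iff)
    also have "(\<Sum>k. b k * z ^ k) = g z" using g[OF z] by (simp add: sums_iff)
    also have "(\<lambda>n. \<Sum>j\<le>n. (d j * z ^ j) * (b (n - j) * z ^ (n - j)))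
        = (\<lambda>n. (\<Sum>j\<le>n. d j * b (n - j)) * z ^ n)"
    proof (rule ext)
      fix n
      show "(\<Sum>j\<le>n. (d j * z ^ j) * (b (n - j) * z ^ (n - j)))
          = (\<Sum>j\<le>n. d j * b (n - j)) * z ^ n"
        unfolding sum_distrib_right
      proof (rule sum.cong)
        fix j assume "j \<in> {..n}"
        then have "z ^ j * z ^ (n - j) = z ^ n" by (simp flip: power_add)
        then show "(d j * z ^ j) * (b (n - j) * z ^ (n - j)) = d j * b (n - j) * z ^ n"
          by (metis mult.assoc mult.left_commute)
      qed simp
    qed
    finally show ?thesis .
  qed
  with convolution_weighted_square_summable[OF \<open>0 \<le> a\<close> d b]
  show "(\<lambda>z. \<phi> z * g z) \<in> dirichlet_disc a"
    unfolding dirichlet_disc_def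
    by (intro CollectI exI[of _ "\<lambda>n. \<Sum>j\<le>n. d j * b (n - j)"]) simp
qed

lemma dirichlet_disc_antimono:
  assumes "a \<le> b"
  shows "dirichlet_disc b \<subseteq> dirichlet_disc a"
proof
  fix g assume "g \<in> dirichlet_disc b"
  then obtain c where c: "summable (\<lambda>k. (cmod (c k))\<^sup>2 * (real k + 1) powr b)"
    and g: "\<forall>z \<in> unit_disc. (\<lambda>k. c k * z ^ k) sums g z"
    unfolding dirichlet_disc_def by auto
  have "summable (\<lambda>k. (cmod (c k))\<^sup>2 * (real k + 1) powr a)"
    by (rule summable_comparison_test'[OF c, of 0])
       (auto intro!: mult_left_mono powr_mono assms)
  with g show "g \<in> dirichlet_disc a"
    unfolding dirichlet_disc_def by blast
qed

lemma power_series_coeffs_unique: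
  fixes a b :: "nat \<Rightarrow> complex"
  assumes "\<And>z. z \<in> unit_disc \<Longrightarrow> (\<lambda>n. a n * z ^ n) sums f z"
    and "\<And>z. z \<in> unit_disc \<Longrightarrow> (\<lambda>n. b n * z ^ n) sums f z"
  shows "a = b"
proof -
  have ev: "eventually (\<lambda>z. z \<in> unit_disc) (nhds (0 :: complex))"
    by (rule eventually_nhds_in_open) auto
  have "f has_fps_expansion Abs_fps a" "f has_fps_expansion Abs_fps b"
    by (rule has_fps_expansionI, rule eventually_mono[OF ev], use assms in simp)+
  then have "Abs_fps a = Abs_fps b" by (rule fps_expansion_unique_complex)
  then show ?thesis by (simp add: fps_eq_iff fun_eq_iff)
qed

text \<open>Uniqueness of a double power series, reduced twice to one variable. For fixed \<open>w\<close>,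
  comparison of the coefficients of \<open>z ^ k\<close> shows that the row \<open>\<Sum>l. a (k, l) * w ^ l\<close> equals
  \<open>c k * w ^ k\<close>; comparison of the coefficients of \<open>w ^ k\<close> in this identity gives the claim.\<close>

lemma diagonal_coeffs:
  fixes a :: "nat \<times> nat \<Rightarrow> complex" and c :: "nat \<Rightarrow> complex"
  assumes a: "\<And>z w. z \<in> unit_disc \<Longrightarrow> w \<in> unit_disc \<Longrightarrow>
      ((\<lambda>(k, l). a (k, l) * z ^ k * w ^ l) has_sum F (z * w)) UNIV"
    and c: "\<And>z. z \<in> unit_disc \<Longrightarrow> (\<lambda>k. c k * z ^ k) sums F z"
  shows "a (k, k) = c k"
proof -
  have row: "(\<lambda>l. a (k, l) * w ^ l) sums (c k * w ^ k)" if w: "w \<in> unit_disc" for w k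
  proof -
    define h where "h k = (\<Sum>\<^sub>\<infinity>l. a (k, l) * w ^ l)" for k
    have summ_row: "(\<lambda>l. a (k, l) * w ^ l) summable_on UNIV" for k
    proof -
      (* Any nonzero point of the disc serves to extract the row from the double series. *)
      have "(1 / 2 :: complex) \<in> unit_disc" by (simp add: norm_divide)
      from has_sum_imp_summable[OF a[OF this w]]
      have "(\<lambda>(k, l). a (k, l) * (1 / 2) ^ k * w ^ l) summable_on (UNIV \<times> UNIV)"
        by (simp only: UNIV_Times_UNIV)
      then have "(\<lambda>l. a (k, l) * (1 / 2) ^ k * w ^ l) summable_on UNIV"
        by (rule summable_on_SigmaD1) (rule UNIV_I)
      then have "(\<lambda>l. 2 ^ k * (a (k, l) * (1 / 2) ^ k * w ^ l)) summable_on UNIV"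
        by (rule summable_on_cmult_right)
      also have "(\<lambda>l. 2 ^ k * (a (k, l) * (1 / 2) ^ k * w ^ l)) = (\<lambda>l. a (k, l) * w ^ l)"
        by (simp add: power_one_over)
      finally show ?thesis .
    qed
    have "(\<lambda>k. h k * z ^ k) sums F (z * w)" if z: "z \<in> unit_disc" for z
    proof (rule has_sum_imp_sums)
      show "((\<lambda>k. h k * z ^ k) has_sum F (z * w)) UNIV"
      proof (rule has_sum_SigmaD)
        show "((\<lambda>(k, l). a (k, l) * z ^ k * w ^ l) has_sum F (z * w)) (UNIV \<times> UNIV)"
          using a[OF z w] by simp
        show "((\<lambda>l. case (k, l) of (k, l) \<Rightarrow> a (k, l) * z ^ k * w ^ l) has_sum h k * z ^ k) UNIV" for k
          using has_sum_cmult_left[OF has_sum_infsum[OF summ_row[of k]], of "z ^ k"]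
          by (simp add: h_def mult_ac)
      qed
    qed
    moreover have "(\<lambda>k. (c k * w ^ k) * z ^ k) sums F (z * w)" if z: "z \<in> unit_disc" for z
      using c[OF mult_in_unit_disc[OF z w]] by (simp add: power_mult_distrib mult_ac)
    ultimately have "h = (\<lambda>k. c k * w ^ k)" by (rule power_series_coeffs_unique)
    then show ?thesis
      using has_sum_imp_sums[OF has_sum_infsum[OF summ_row[of k]]] by (simp add: h_def fun_eq_iff)
  qed
  have "(\<lambda>l. a (k, l)) = (\<lambda>l. if l = k then c k else 0)"
  proof (rule power_series_coeffs_unique)
    show "(\<lambda>l. a (k, l) * w ^ l) sums (c k * w ^ k)" if "w \<in> unit_disc" for w
      by (rule row[OF that])
    show "(\<lambda>l. (if l = k then c k else 0) * w ^ l) sums (c k * w ^ k)" for w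
      using sums_single[of k "\<lambda>l. c k * w ^ l"] by (simp add: if_distrib[of "\<lambda>x. x * _"] cong: if_cong)
  qed
  then show ?thesis by (simp add: fun_eq_iff)
qed

lemma const_one_in_dirichlet_bidisc: "(\<lambda>_. 1) \<in> dirichlet_bidisc \<gamma>"
proof -
  define a :: "nat \<times> nat \<Rightarrow> complex" where "a = (\<lambda>p. if p = (0, 0) then 1 else 0)"
  have "(\<lambda>(k, l). (cmod (a (k, l)))\<^sup>2 * (real k + 1) powr fst \<gamma> * (real l + 1) powr snd \<gamma>)
      summable_on UNIV"
    by (subst summable_on_cong_neutral[where T = "{(0, 0)}" and g = "\<lambda>_. 1"]) (auto simp: a_def split: if_splits)
  moreover have "((\<lambda>(k, l). a (k, l) * z ^ k * w ^ l) has_sum 1) UNIV" for z w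
    using has_sum_finite[of "{(0, 0)}" "\<lambda>_. 1 :: complex"]
    by (subst has_sum_cong_neutral[where T = "{(0, 0)}" and g = "\<lambda>_. 1"])
       (auto simp: a_def split: if_splits)
  ultimately show ?thesis unfolding dirichlet_bidisc_def by blast
qed

theorem proposition4p9:
  fixes \<gamma> \<alpha> :: "real \<times> real"
  assumes "fst \<gamma> > 1" and "snd \<gamma> > 1"
    and "fst \<alpha> \<le> fst \<gamma>" and "snd \<alpha> \<le> snd \<gamma>"
  shows "\<exists>f :: complex \<times> complex \<Rightarrow> complex.
    (\<forall>w\<^sub>0 \<in> unit_disc. (\<lambda>z. f (z, w\<^sub>0)) \<in> multipliers (dirichlet_disc (fst \<gamma>)) (dirichlet_disc (fst \<alpha>))) \<and>
    (\<forall>z\<^sub>0 \<in> unit_disc. (\<lambda>w. f (z\<^sub>0, w)) \<in> multipliers (dirichlet_disc (snd \<gamma>)) (dirichlet_disc (snd \<alpha>))) \<and>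
    f \<notin> multipliers (dirichlet_bidisc \<gamma>) (dirichlet_bidisc \<alpha>)"
proof -
  define s where "s = - (fst \<alpha> + snd \<alpha>) / 2"
  define c where "c k = complex_of_real ((real k + 1) powr s)" for k
  define F where "F x = (\<Sum>k. c k * x ^ k)" for x
  define f :: "complex \<times> complex \<Rightarrow> complex" where "f = (\<lambda>(z, w). F (z * w))"
  have F: "(\<lambda>k. c k * x ^ k) sums F x" if "x \<in> unit_disc" for x
  proof -
    have "summable (\<lambda>k. norm (c k * x ^ k))"
      using summable_powr_times_geometric[of "cmod x" s] that
      by (simp add: c_def norm_mult norm_power)
    then show ?thesis unfolding F_def by (rule summable_sums[OF summable_norm_cancel])
  qed
  have slice: "(\<lambda>z. F (z * x)) \<in> multipliers (dirichlet_disc g) (dirichlet_disc a)"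
    if x: "x \<in> unit_disc" and g: "0 \<le> g" "a \<le> g" for x g a
  proof -
    have "(\<lambda>z. F (z * x)) \<in> multipliers (dirichlet_disc g) (dirichlet_disc g)"
    proof (rule multiplier_of_weighted_summable[where d = "\<lambda>k. c k * x ^ k"])
      show "summable (\<lambda>j. cmod (c j * x ^ j) * (real j + 1) powr (g / 2))"
        using summable_powr_times_geometric[of "cmod x" "s + g / 2"] x
        by (simp add: c_def norm_mult norm_power powr_add mult_ac)
      show "(\<lambda>j. c j * x ^ j * z ^ j) sums F (z * x)" if "z \<in> unit_disc" for z
        using F[OF mult_in_unit_disc[OF that x]] by (simp add: power_mult_distrib mult_ac)
    qed (rule g)
    with dirichlet_disc_antimono[OF g(2)] show ?thesis
      unfolding multipliers_def by blast
  qed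
  have "f \<notin> multipliers (dirichlet_bidisc \<gamma>) (dirichlet_bidisc \<alpha>)"
  proof
    assume "f \<in> multipliers (dirichlet_bidisc \<gamma>) (dirichlet_bidisc \<alpha>)"
    then have "\<forall>g \<in> dirichlet_bidisc \<gamma>. (\<lambda>x. f x * g x) \<in> dirichlet_bidisc \<alpha>"
      unfolding multipliers_def by (rule CollectD)
    from bspec[OF this const_one_in_dirichlet_bidisc]
    have "(\<lambda>x. f x * 1) \<in> dirichlet_bidisc \<alpha>" .
    then obtain a where
      a: "(\<lambda>(k, l). (cmod (a (k, l)))\<^sup>2 * (real k + 1) powr fst \<alpha> * (real l + 1) powr snd \<alpha>)
        summable_on UNIV"
      and expansion: "\<And>z w. z \<in> unit_disc \<Longrightarrow> w \<in> unit_disc \<Longrightarrow>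
        ((\<lambda>(k, l). a (k, l) * z ^ k * w ^ l) has_sum F (z * w)) UNIV"
      unfolding dirichlet_bidisc_def f_def by auto
    have diag: "a (k, k) = c k" for k
      using expansion F by (rule diagonal_coeffs)
    have one: "(cmod (a (k, k)))\<^sup>2 * (real k + 1) powr fst \<alpha> * (real k + 1) powr snd \<alpha> = 1" for k
      by (simp add: diag c_def s_def power2_eq_square flip: powr_add)
    have "(\<lambda>(k, l). (cmod (a (k, l)))\<^sup>2 * (real k + 1) powr fst \<alpha> * (real l + 1) powr snd \<alpha>)
        summable_on range (\<lambda>k. (k, k))"
      by (rule summable_on_subset_banach[OF a]) simp
    then have "(\<lambda>k :: nat. 1 :: real) summable_on UNIV"
      by (subst (asm) summable_on_reindex) (simp_all add: inj_on_def o_def one)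
    then have "summable (\<lambda>k :: nat. 1 :: real)" by (rule summable_on_imp_summable)
    then show False by (simp add: summable_const_iff)
  qed
  moreover have "(\<lambda>z. f (z, w)) \<in> multipliers (dirichlet_disc (fst \<gamma>)) (dirichlet_disc (fst \<alpha>))"
    if "w \<in> unit_disc" for w
    using slice[OF that, of "fst \<gamma>" "fst \<alpha>"] assms by (simp add: f_def)
  moreover have "(\<lambda>w. f (z, w)) \<in> multipliers (dirichlet_disc (snd \<gamma>)) (dirichlet_disc (snd \<alpha>))"
    if "z \<in> unit_disc" for z
    using slice[OF that, of "snd \<gamma>" "snd \<alpha>"] assms by (simp add: f_def mult.commute)
  ultimately show ?thesis by blast
qed

end
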